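(* Let $(X_t)_{t\ge1}$ be a sequence of random variables such that, for constants $\mu,\sigma^2$ and all $t\ge 1$, $X_t\in[0,1]$, $\mathbb{E}_{t-1}X_t=\mu$ and $\mathbb{V}_{t-1}X_t=\sigma^2$. Let $(\widehat\mu_i)_{i\ge1}$ be a $[0,1]$-valued predictable sequence and denote $\tilde\sigma_i^2=\sigma^2+(\widehat\mu_i-\mu)^2$. Then for any $[0,1]$-valued predictable sequence $(\widehat\sigma_i)_{i\ge1}$ and any $[0,1)$-valued predictable sequence $(\lambda_i)_{i\ge1}$, the processes $(S_t^+)_{t\ge0}$ and $(S_t^-)_{t\ge0}$ defined by $S_0^+=S_0^-=1$ and $$S_t^{\pm}=\exp\Bigg\{\sum_{i\le t}\Big(\pm\lambda_i\big[(X_i-\widehat\mu_i)^2-\tilde\sigma_i^2\big]-\psi_E(\lambda_i)\big[(X_i-\widehat\mu_i)^2-\widehat\sigma_i^2\big]^2\Big)\Bigg\},\quad t\ge1,$$ are nonnegative supermartingales.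
   Context: All random variables live on a common probability space. $\mathcal{F}_t=\sigma(X_1,\dots,X_t)$ is the canonical filtration, with $\mathcal{F}_0$ trivial; $\mathbb{E}_t[\cdot]=\mathbb{E}[\cdot\mid\mathcal{F}_t]$ and $\mathbb{V}_t[\cdot]=\mathbb{V}[\cdot\mid\mathcal{F}_t]$ (conditional variance). Relations between random variables hold almost surely. A sequence $(M_i)_{i\ge1}$ is predictable if $M_i$ is $\mathcal{F}_{i-1}$-measurable for all $i\geq 1$. An integrable adapted process $(M_t)_{t\ge0}$ is a supermartingale if $\mathbb{E}[M_{t+1}\mid\mathcal{F}_t]\le M_t$ for all $t\ge 0$. For $\lambda\in[0,1)$, $\psi_E(\lambda)=-\log(1-\lambda)-\lambda$. *)

theory Defs
  imports "HOL-Probability.Probability"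
begin

text \<open>Time indices of \<open>X\<close> start at 1; for \<open>t = 0\<close> the generating family is empty, so the
  \<open>\<sigma>\<close>-algebra is the trivial one on \<open>space M\<close>.\<close>

definition canonical_filtration ::
  "'a measure \<Rightarrow> (nat \<Rightarrow> 'a \<Rightarrow> real) \<Rightarrow> nat \<Rightarrow> 'a measure" where
  "canonical_filtration M X t =
     sigma (space M) (\<Union>i\<in>{1..t}. {X i -` A \<inter> space M | A. A \<in> sets borel})"

definition real_cond_var :: "'a measure \<Rightarrow> 'a measure \<Rightarrow> ('a \<Rightarrow> real) \<Rightarrow> 'a \<Rightarrow> real" where
  "real_cond_var M F X = real_cond_exp M F (\<lambda>\<omega>. (X \<omega> - real_cond_exp M F X \<omega>)\<^sup>2)"

definition predictable :: "(nat \<Rightarrow> 'a measure) \<Rightarrow> (nat \<Rightarrow> 'a \<Rightarrow> real) \<Rightarrow> bool" where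
  "predictable F Y \<longleftrightarrow> (\<forall>i\<ge>1. Y i \<in> borel_measurable (F (i - 1)))"

definition supermartingale ::
  "'a measure \<Rightarrow> (nat \<Rightarrow> 'a measure) \<Rightarrow> (nat \<Rightarrow> 'a \<Rightarrow> real) \<Rightarrow> bool" where
  "supermartingale M F Y \<longleftrightarrow>
     filtration (space M) F \<and> (\<forall>t. subalgebra M (F t)) \<and>
     (\<forall>t. Y t \<in> borel_measurable (F t)) \<and>
     (\<forall>t. integrable M (Y t)) \<and>
     (\<forall>t. AE \<omega> in M. real_cond_exp M (F t) (Y (t + 1)) \<omega> \<le> Y t \<omega>)"

definition nonneg_supermartingale ::
  "'a measure \<Rightarrow> (nat \<Rightarrow> 'a measure) \<Rightarrow> (nat \<Rightarrow> 'a \<Rightarrow> real) \<Rightarrow> bool" where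
  "nonneg_supermartingale M F Y \<longleftrightarrow>
     supermartingale M F Y \<and> (\<forall>t. AE \<omega> in M. 0 \<le> Y t \<omega>)"

definition psi_E :: "real \<Rightarrow> real" where
  "psi_E l = - ln (1 - l) - l"

text \<open>The sign \<open>s\<close> is \<open>1\<close> for the process \<open>S\<^sup>+\<close> and \<open>-1\<close> for \<open>S\<^sup>-\<close>; \<open>mh\<close>, \<open>sh\<close> and \<open>l\<close> are the
  predictable sequences of mean estimates, standard deviation estimates and tuning
  parameters, and \<open>\<sigma>\<^sup>2 + (mh i - \<mu>)\<^sup>2\<close> is \<open>\<sigma>\<close>-tilde squared at index \<open>i\<close>.  The empty sum gives
  the initial value \<open>1\<close> at \<open>t = 0\<close>.\<close>

definition S_process ::
  "real \<Rightarrow> real \<Rightarrow> real \<Rightarrow> (nat \<Rightarrow> 'a \<Rightarrow> real) \<Rightarrow> (nat \<Rightarrow> 'a \<Rightarrow> real) \<Rightarrow> (nat \<Rightarrow> 'a \<Rightarrow> real) \<Rightarrow>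
   (nat \<Rightarrow> 'a \<Rightarrow> real) \<Rightarrow> nat \<Rightarrow> 'a \<Rightarrow> real" where
  "S_process s \<mu> \<sigma> X mh sh l t \<omega> =
     exp (\<Sum>i=1..t.
            s * l i \<omega> * ((X i \<omega> - mh i \<omega>)\<^sup>2 - (\<sigma>\<^sup>2 + (mh i \<omega> - \<mu>)\<^sup>2))
            - psi_E (l i \<omega>) * ((X i \<omega> - mh i \<omega>)\<^sup>2 - (sh i \<omega>)\<^sup>2)\<^sup>2)"

end

theory Submission
  imports Defs
begin

text \<open>
  Write \<open>y = (x - m)\<^sup>2 - v\<^sup>2\<close> for the observed squared deviation minus its prediction.  As all
  three numbers lie in \<open>[0, 1]\<close>, so does \<open>\<bar>y\<bar>\<close>; this makes both \<open>y\<close> and \<open>-y\<close> at least \<open>-1\<close> and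
  is what allows the two signs \<open>s = 1\<close> and \<open>s = -1\<close> to be treated alike.  Fan's inequality
  \<open>exp (l z - psi_E l z\<^sup>2) \<le> 1 + l z\<close> for \<open>z \<ge> -1\<close> (lemma \<open>exp_sub_psi_E_le\<close>), used at
  \<open>z = s y\<close>, removes the quadratic penalty at no cost.

  The process, however, is centred at \<open>\<sigma>\<^sup>2 + (m - \<mu>)\<^sup>2\<close>, not at \<open>v\<^sup>2\<close>.  With the difference
  \<open>c = \<sigma>\<^sup>2 + (m - \<mu>)\<^sup>2 - v\<^sup>2\<close>, which is known before \<open>x\<close> is observed, one factor of the process
  is \<open>exp (- s l c) exp (s l y - psi_E l y\<^sup>2)\<close>, hence at most \<open>exp (- s l c) (1 + s l y)\<close>.  This bound
  is a quadratic polynomial in \<open>x\<close> with predictable coefficients, so its conditional expectation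
  is determined by the first two conditional moments, and these make \<open>c\<close> the conditional expectation
  of \<open>y\<close>.  What remains is \<open>exp (- s l c) (1 + s l c) \<le> 1\<close>, that is \<open>1 + u \<le> exp u\<close>
  (lemma \<open>real_cond_exp_exp_S_increment_le_1\<close>).

  Each factor is also bounded by a constant, so every finite product of factors is integrable;
  the earlier factors can then be pulled out of the conditional expectation, which gives the
  supermartingale property.
\<close>

section \<open>Deterministic inequalities\<close>

text \<open>
  Fan's inequality.  In logarithmic form both sides agree at \<open>l = 0\<close>, and the derivative in \<open>l\<close> of
  their difference factors as \<open>l x\<^sup>2 (1 / (1 - l) - 1 / (1 + l x))\<close>, which is nonnegative because
  \<open>x \<ge> -1\<close> gives \<open>1 + l x \<ge> 1 - l\<close>.
\<close>

lemma exp_sub_psi_E_le: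
  fixes l x :: real
  assumes l: "0 \<le> l" "l < 1" and x: "-1 \<le> x"
  shows "exp (l * x - psi_E l * x\<^sup>2) \<le> 1 + l * x"
proof -
  define g where "g u = ln (1 + u * x) - u * x + psi_E u * x\<^sup>2" for u
  have pos: "1 + u * x \<ge> 1 - u" "1 - u > 0" if "0 \<le> u" "u \<le> l" for u
    using that l mult_left_mono[OF x, of u] by auto
  have "g 0 \<le> g l"
  proof (rule DERIV_nonneg_imp_nondecreasing[OF l(1)])
    fix u assume u: "0 \<le> u" "u \<le> l"
    note p = pos[OF u]
    have "(g has_real_derivative
        x / (1 + u * x) - x + (1 / (1 - u) - 1) * x\<^sup>2) (at u)"
      unfolding g_def psi_E_def
      using p by (auto intro!: derivative_eq_intros simp: field_simps)
    moreover have "x / (1 + u * x) - x + (1 / (1 - u) - 1) * x\<^sup>2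
        = u * x\<^sup>2 * (1 / (1 - u) - 1 / (1 + u * x))"
    proof -
      have "x / (1 + u * x) - x = - u * x\<^sup>2 / (1 + u * x)"
        using p by (simp add: field_simps power2_eq_square)
      moreover have "1 / (1 - u) - 1 = u / (1 - u)"
        using p by (simp add: field_simps)
      ultimately show ?thesis by (simp only:) (simp add: right_diff_distrib)
    qed
    moreover have "1 / (1 + u * x) \<le> 1 / (1 - u)"
      using p by (intro divide_left_mono) auto
    ultimately show "\<exists>y. (g has_real_derivative y) (at u) \<and> 0 \<le> y"
      using u by fastforce
  qed
  then have "l * x - psi_E l * x\<^sup>2 \<le> ln (1 + l * x)"
    by (simp add: g_def psi_E_def)
  then show ?thesis
    using pos[of l] l by (metis exp_le_cancel_iff exp_ln less_le_trans order_refl)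
qed

lemma abs_diff_squares_le_1:
  fixes y v :: real
  assumes "\<bar>y\<bar> \<le> 1" "\<bar>v\<bar> \<le> 1"
  shows "\<bar>y\<^sup>2 - v\<^sup>2\<bar> \<le> 1"
proof -
  have "y\<^sup>2 \<le> 1" "v\<^sup>2 \<le> 1" using assms abs_square_le_1 by blast+
  then show ?thesis
    using zero_le_power2[of y] zero_le_power2[of v] by linarith
qed

definition S_increment :: "real \<Rightarrow> real \<Rightarrow> real \<Rightarrow> real \<Rightarrow> real \<Rightarrow> real \<Rightarrow> real \<Rightarrow> real" where
  "S_increment s \<mu> \<sigma> x m v l =
     s * l * ((x - m)\<^sup>2 - (\<sigma>\<^sup>2 + (m - \<mu>)\<^sup>2)) - psi_E l * ((x - m)\<^sup>2 - v\<^sup>2)\<^sup>2"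

text \<open>
  The factor \<open>exp (- s l c)\<close>, with \<open>c = \<sigma>\<^sup>2 + (m - \<mu>)\<^sup>2 - v\<^sup>2\<close>, that moves the centre from
  the prediction \<open>v\<^sup>2\<close> to the conditional mean
  \<open>\<sigma>\<^sup>2 + (m - \<mu>)\<^sup>2\<close> of the squared deviation.  The observation \<open>x\<close> does not occur in it, so it is
  predictable.
\<close>

definition recentring :: "real \<Rightarrow> real \<Rightarrow> real \<Rightarrow> real \<Rightarrow> real \<Rightarrow> real \<Rightarrow> real" where
  "recentring s \<mu> \<sigma> m v l = exp (- (s * l * (\<sigma>\<^sup>2 + (m - \<mu>)\<^sup>2 - v\<^sup>2)))"

text \<open>
  Fan's inequality at \<open>s y\<close>: the sign disappears from the penalty since \<open>s\<^sup>2 = 1\<close>, and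
  the bound that is left is quadratic in \<open>x\<close>.
\<close>

lemma exp_S_increment_le:
  assumes s: "s \<in> {1, -1}" and "m \<in> {0..1}" "v \<in> {0..1}" "x \<in> {0..1}" "l \<in> {0..<1}"
  shows "exp (S_increment s \<mu> \<sigma> x m v l)
     \<le> recentring s \<mu> \<sigma> m v l * (1 + s * l * ((x - m)\<^sup>2 - v\<^sup>2))"
proof -
  let ?y = "(x - m)\<^sup>2 - v\<^sup>2"
  have "\<bar>?y\<bar> \<le> 1" using assms by (intro abs_diff_squares_le_1) auto
  then have "-1 \<le> s * ?y" using s by (auto simp: abs_le_iff)
  then have "exp (l * (s * ?y) - psi_E l * (s * ?y)\<^sup>2) \<le> 1 + l * (s * ?y)"
    using assms by (intro exp_sub_psi_E_le) auto
  then have "recentring s \<mu> \<sigma> m v l * exp (l * (s * ?y) - psi_E l * (s * ?y)\<^sup>2)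
     \<le> recentring s \<mu> \<sigma> m v l * (1 + l * (s * ?y))"
    by (intro mult_left_mono) (auto simp: recentring_def)
  moreover have "recentring s \<mu> \<sigma> m v l * exp (l * (s * ?y) - psi_E l * (s * ?y)\<^sup>2)
      = exp (S_increment s \<mu> \<sigma> x m v l)"
    using s
    by (auto simp: recentring_def S_increment_def exp_add[symmetric] right_diff_distrib
        power2_commute[of "(x - m)\<^sup>2"])
  ultimately show ?thesis by (simp add: mult.left_commute mult.assoc)
qed

text \<open>
  The next two bounds serve integrability, so they must be uniform in \<open>x\<close>, \<open>m\<close>, \<open>v\<close>, \<open>l\<close>.  The
  second reuses Fan's inequality to eliminate \<open>psi_E l\<close>, which is unbounded near \<open>l = 1\<close>.
\<close>

lemma recentring_le:
  assumes s: "s \<in> {1, -1}" and "m \<in> {0..1}" "v \<in> {0..1}" "l \<in> {0..<1}"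
  shows "recentring s \<mu> \<sigma> m v l \<le> exp (\<sigma>\<^sup>2 + (1 + \<bar>\<mu>\<bar>)\<^sup>2 + 1)"
proof -
  let ?c = "\<sigma>\<^sup>2 + (m - \<mu>)\<^sup>2 - v\<^sup>2"
  have "\<bar>m - \<mu>\<bar> \<le> \<bar>1 + \<bar>\<mu>\<bar>\<bar>" "\<bar>v\<bar> \<le> 1" using assms by auto
  then have "(m - \<mu>)\<^sup>2 \<le> (1 + \<bar>\<mu>\<bar>)\<^sup>2" "v\<^sup>2 \<le> 1"
    using abs_le_square_iff abs_square_le_1 by blast+
  then have c: "\<bar>?c\<bar> \<le> \<sigma>\<^sup>2 + (1 + \<bar>\<mu>\<bar>)\<^sup>2 + 1"
    using zero_le_power2[of \<sigma>] zero_le_power2[of "m - \<mu>"] zero_le_power2[of v] by linarith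
  have "- (s * l * ?c) \<le> \<bar>s * l * ?c\<bar>" by simp
  also have "\<dots> = l * \<bar>?c\<bar>" using assms by (auto simp: abs_mult)
  also have "\<dots> \<le> 1 * \<bar>?c\<bar>" using assms by (intro mult_right_mono) auto
  finally show ?thesis using c by (simp add: recentring_def)
qed

lemma exp_S_increment_bounded:
  assumes "s \<in> {1, -1}" "m \<in> {0..1}" "v \<in> {0..1}" "x \<in> {0..1}" "l \<in> {0..<1}"
  shows "exp (S_increment s \<mu> \<sigma> x m v l) \<le> 2 * exp (\<sigma>\<^sup>2 + (1 + \<bar>\<mu>\<bar>)\<^sup>2 + 1)"
proof -
  let ?y = "(x - m)\<^sup>2 - v\<^sup>2"
  have "\<bar>?y\<bar> \<le> 1" using assms by (intro abs_diff_squares_le_1) auto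
  then have "l * \<bar>?y\<bar> \<le> 1 * 1" using assms by (intro mult_mono) auto
  moreover have "s * l * ?y \<le> \<bar>s * l * ?y\<bar>" by simp
  moreover have "\<bar>s * l * ?y\<bar> = l * \<bar>?y\<bar>" using assms by (auto simp: abs_mult)
  ultimately have "1 + s * l * ?y \<le> 2" by linarith
  then have "recentring s \<mu> \<sigma> m v l * (1 + s * l * ?y) \<le> recentring s \<mu> \<sigma> m v l * 2"
    by (intro mult_left_mono) (auto simp: recentring_def)
  then show ?thesis
    using exp_S_increment_le[OF assms(1-5), of \<mu> \<sigma>] recentring_le[OF assms(1-3,5), of \<mu> \<sigma>]
    by linarith
qed

section \<open>Conditional expectation of one factor\<close>

context finite_measure_subalgebra
begin

lemma real_cond_exp_bounded_mult:
  assumes [measurable]: "f \<in> borel_measurable F" "g \<in> borel_measurable M"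
    and f: "AE \<omega> in M. \<bar>f \<omega>\<bar> \<le> B" and g: "AE \<omega> in M. \<bar>g \<omega>\<bar> \<le> C"
  shows "integrable M (\<lambda>\<omega>. f \<omega> * g \<omega>)"
    and "AE \<omega> in M. real_cond_exp M F (\<lambda>\<omega>. f \<omega> * g \<omega>) \<omega> = f \<omega> * real_cond_exp M F g \<omega>"
proof -
  have [measurable]: "f \<in> borel_measurable M"
    using measurable_from_subalg[OF subalg assms(1)] .
  show int: "integrable M (\<lambda>\<omega>. f \<omega> * g \<omega>)"
  proof (rule integrable_const_bound[where B = "B * C"])
    show "AE \<omega> in M. norm (f \<omega> * g \<omega>) \<le> B * C"
      using f g by eventually_elim (auto simp: abs_mult intro!: mult_mono)
  qed auto
  show "AE \<omega> in M. real_cond_exp M F (\<lambda>\<omega>. f \<omega> * g \<omega>) \<omega> = f \<omega> * real_cond_exp M F g \<omega>"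
    by (rule real_cond_exp_mult[OF _ _ int]) auto
qed

lemma real_cond_exp_quadratic:
  assumes [measurable]: "a \<in> borel_measurable F" "b \<in> borel_measurable F" "d \<in> borel_measurable F"
      "X \<in> borel_measurable M"
    and bd: "AE \<omega> in M. \<bar>a \<omega>\<bar> \<le> C" "AE \<omega> in M. \<bar>b \<omega>\<bar> \<le> C" "AE \<omega> in M. \<bar>d \<omega>\<bar> \<le> C"
    and X: "AE \<omega> in M. \<bar>X \<omega>\<bar> \<le> 1"
    and m1: "AE \<omega> in M. real_cond_exp M F X \<omega> = \<mu>"
    and m2: "AE \<omega> in M. real_cond_exp M F (\<lambda>\<omega>. (X \<omega>)\<^sup>2) \<omega> = q"
  shows "integrable M (\<lambda>\<omega>. a \<omega> + b \<omega> * X \<omega> + d \<omega> * (X \<omega>)\<^sup>2)"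
    and "AE \<omega> in M. real_cond_exp M F (\<lambda>\<omega>. a \<omega> + b \<omega> * X \<omega> + d \<omega> * (X \<omega>)\<^sup>2) \<omega>
      = a \<omega> + b \<omega> * \<mu> + d \<omega> * q"
proof -
  have X2: "AE \<omega> in M. \<bar>(X \<omega>)\<^sup>2\<bar> \<le> 1"
    using X by eventually_elim (simp add: abs_square_le_1)
  have [measurable]: "a \<in> borel_measurable M"
    using measurable_from_subalg[OF subalg assms(1)] .
  have ia: "integrable M a"
    by (rule integrable_const_bound[where B = C]) (use bd in auto)
  note b = real_cond_exp_bounded_mult[OF assms(2) assms(4) bd(2) X]
  have "(\<lambda>\<omega>. (X \<omega>)\<^sup>2) \<in> borel_measurable M" by measurable
  note d = real_cond_exp_bounded_mult[OF assms(3) this bd(3) X2]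
  have iab: "integrable M (\<lambda>\<omega>. a \<omega> + b \<omega> * X \<omega>)"
    using ia b by simp
  show "integrable M (\<lambda>\<omega>. a \<omega> + b \<omega> * X \<omega> + d \<omega> * (X \<omega>)\<^sup>2)"
    using iab d by simp
  show "AE \<omega> in M. real_cond_exp M F (\<lambda>\<omega>. a \<omega> + b \<omega> * X \<omega> + d \<omega> * (X \<omega>)\<^sup>2) \<omega>
      = a \<omega> + b \<omega> * \<mu> + d \<omega> * q"
    using real_cond_exp_add[OF iab d(1)] real_cond_exp_add[OF ia b(1)]
      real_cond_exp_F_meas[OF ia assms(1)] b(2) d(2) m1 m2
    by eventually_elim simp
qed

text \<open>
  The conditional version of \<open>E X\<^sup>2 = V X + (E X)\<^sup>2\<close>.  Since the conditional mean is almost surely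
  constant, \<open>X\<^sup>2\<close> differs from the squared deviation defining the conditional variance by
  an affine function of \<open>X\<close> with constant coefficients.
\<close>

lemma real_cond_exp_square_of_cond_var:
  assumes [measurable]: "X \<in> borel_measurable M"
    and X: "AE \<omega> in M. \<bar>X \<omega>\<bar> \<le> 1"
    and m1: "AE \<omega> in M. real_cond_exp M F X \<omega> = \<mu>"
    and var: "AE \<omega> in M. real_cond_var M F X \<omega> = \<sigma>\<^sup>2"
  shows "AE \<omega> in M. real_cond_exp M F (\<lambda>\<omega>. (X \<omega>)\<^sup>2) \<omega> = \<sigma>\<^sup>2 + \<mu>\<^sup>2"
proof -
  let ?Y = "\<lambda>\<omega>. (X \<omega> - real_cond_exp M F X \<omega>)\<^sup>2"
  have iX: "integrable M X"
    by (rule integrable_const_bound[where B = 1]) (use X in auto)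
  have iY: "integrable M ?Y"
  proof (rule integrable_const_bound[where B = "(1 + \<bar>\<mu>\<bar>)\<^sup>2"])
    show "AE \<omega> in M. norm (?Y \<omega>) \<le> (1 + \<bar>\<mu>\<bar>)\<^sup>2"
      using X m1 by eventually_elim (auto simp: abs_le_square_iff[symmetric])
  qed auto
  have ilin: "integrable M (\<lambda>\<omega>. 2 * \<mu> * X \<omega> - \<mu>\<^sup>2)"
    using iX by simp
  have "AE \<omega> in M. real_cond_exp M F (\<lambda>\<omega>. (X \<omega>)\<^sup>2) \<omega>
      = real_cond_exp M F (\<lambda>\<omega>. ?Y \<omega> + (2 * \<mu> * X \<omega> - \<mu>\<^sup>2)) \<omega>"
  proof (rule real_cond_exp_cong)
    show "AE \<omega> in M. (X \<omega>)\<^sup>2 = ?Y \<omega> + (2 * \<mu> * X \<omega> - \<mu>\<^sup>2)"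
      using m1 by eventually_elim (simp add: power2_eq_square algebra_simps)
  qed auto
  moreover have "AE \<omega> in M. real_cond_exp M F (\<lambda>\<omega>. 2 * \<mu> * X \<omega> - \<mu>\<^sup>2) \<omega> = 2 * \<mu> * \<mu> - \<mu>\<^sup>2"
  proof -
    have i: "integrable M (\<lambda>\<omega>. 2 * \<mu> * X \<omega>)" "integrable M (\<lambda>_. \<mu>\<^sup>2)"
      using iX by auto
    have "AE \<omega> in M. real_cond_exp M F (\<lambda>_. \<mu>\<^sup>2) \<omega> = \<mu>\<^sup>2"
      by (rule real_cond_exp_F_meas[OF i(2)]) simp
    with real_cond_exp_diff[OF i] real_cond_exp_cmult[OF iX, of "2 * \<mu>"] m1
    show ?thesis by eventually_elim simp
  qed
  ultimately show ?thesis
    using real_cond_exp_add[OF iY ilin] var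
    unfolding real_cond_var_def
    by eventually_elim (simp add: power2_eq_square)
qed

text \<open>
  The one-step estimate.  The coefficients \<open>a\<close>, \<open>b\<close>, \<open>d\<close> below come from expanding the bound of
  \<open>exp_S_increment_le\<close> in powers of \<open>X\<close>; in them only \<open>F\<close>-measurable quantities remain, so the
  two conditional moments can be substituted for \<open>X\<close> and \<open>X\<^sup>2\<close>.
\<close>

lemma real_cond_exp_exp_S_increment_le_1:
  assumes s: "s \<in> {1, -1}"
    and [measurable]: "X \<in> borel_measurable M"
      "m \<in> borel_measurable F" "v \<in> borel_measurable F" "l \<in> borel_measurable F"
    and rng: "AE \<omega> in M. X \<omega> \<in> {0..1}" "AE \<omega> in M. m \<omega> \<in> {0..1}"
      "AE \<omega> in M. v \<omega> \<in> {0..1}" "AE \<omega> in M. l \<omega> \<in> {0..<1}"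
    and m1: "AE \<omega> in M. real_cond_exp M F X \<omega> = \<mu>"
    and var: "AE \<omega> in M. real_cond_var M F X \<omega> = \<sigma>\<^sup>2"
  shows "AE \<omega> in M. real_cond_exp M F (\<lambda>\<omega>. exp (S_increment s \<mu> \<sigma> (X \<omega>) (m \<omega>) (v \<omega>) (l \<omega>))) \<omega> \<le> 1"
proof -
  define G where "G \<omega> = exp (S_increment s \<mu> \<sigma> (X \<omega>) (m \<omega>) (v \<omega>) (l \<omega>))" for \<omega>
  define K where "K \<omega> = recentring s \<mu> \<sigma> (m \<omega>) (v \<omega>) (l \<omega>)" for \<omega>
  define a where "a \<omega> = K \<omega> * (1 + s * l \<omega> * ((m \<omega>)\<^sup>2 - (v \<omega>)\<^sup>2))" for \<omega>
  define b where "b \<omega> = K \<omega> * (- 2 * s * l \<omega> * m \<omega>)" for \<omega>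
  define d where "d \<omega> = K \<omega> * (s * l \<omega>)" for \<omega>
  define E where "E = exp (\<sigma>\<^sup>2 + (1 + \<bar>\<mu>\<bar>)\<^sup>2 + 1)"
  let ?Q = "\<lambda>\<omega>. a \<omega> + b \<omega> * X \<omega> + d \<omega> * (X \<omega>)\<^sup>2"
  have [measurable]: "K \<in> borel_measurable F" unfolding K_def recentring_def by measurable
  have meas: "a \<in> borel_measurable F" "b \<in> borel_measurable F" "d \<in> borel_measurable F"
    unfolding a_def b_def d_def by measurable
  have [measurable]: "m \<in> borel_measurable M" "v \<in> borel_measurable M" "l \<in> borel_measurable M"
    using assms(3-5) by (auto intro: measurable_from_subalg[OF subalg])
  have GM: "G \<in> borel_measurable M"
    unfolding G_def S_increment_def psi_E_def by measurable
  have bounds: "AE \<omega> in M. \<bar>a \<omega>\<bar> \<le> E * 2 \<and> \<bar>b \<omega>\<bar> \<le> E * 2 \<and> \<bar>d \<omega>\<bar> \<le> E * 2"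
    using rng(2-4)
  proof eventually_elim
    case (elim \<omega>)
    have K: "0 \<le> K \<omega>" "\<bar>K \<omega>\<bar> \<le> E"
      using recentring_le[OF s elim, of \<mu> \<sigma>] by (auto simp: K_def E_def recentring_def)
    have sl: "\<bar>s * l \<omega>\<bar> \<le> 1" using s elim by auto
    have "\<bar>(m \<omega>)\<^sup>2 - (v \<omega>)\<^sup>2\<bar> \<le> 1" using elim by (intro abs_diff_squares_le_1) auto
    then have "\<bar>s * l \<omega>\<bar> * \<bar>(m \<omega>)\<^sup>2 - (v \<omega>)\<^sup>2\<bar> \<le> 1 * 1"
      using sl by (intro mult_mono) auto
    then have 1: "\<bar>1 + s * l \<omega> * ((m \<omega>)\<^sup>2 - (v \<omega>)\<^sup>2)\<bar> \<le> 2"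
      by (simp add: abs_mult[symmetric] abs_le_iff)
    have "\<bar>s * l \<omega>\<bar> * \<bar>m \<omega>\<bar> \<le> 1 * 1"
      using sl elim by (intro mult_mono) auto
    then have 2: "\<bar>- 2 * s * l \<omega> * m \<omega>\<bar> \<le> 2" by (simp add: abs_mult)
    show ?case
      unfolding a_def b_def d_def abs_mult[of "K \<omega>"]
      using 1 2 sl K by (intro conjI mult_mono) auto
  qed
  have X1: "AE \<omega> in M. \<bar>X \<omega>\<bar> \<le> 1" using rng(1) by eventually_elim auto
  have m2: "AE \<omega> in M. real_cond_exp M F (\<lambda>\<omega>. (X \<omega>)\<^sup>2) \<omega> = \<sigma>\<^sup>2 + \<mu>\<^sup>2"
    by (rule real_cond_exp_square_of_cond_var[OF assms(2) X1 m1 var])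
  have bd: "AE \<omega> in M. \<bar>a \<omega>\<bar> \<le> E * 2" "AE \<omega> in M. \<bar>b \<omega>\<bar> \<le> E * 2" "AE \<omega> in M. \<bar>d \<omega>\<bar> \<le> E * 2"
    using bounds by auto
  note Q = real_cond_exp_quadratic[OF meas assms(2) bd X1 m1 m2]
  have iG: "integrable M G"
  proof (rule integrable_const_bound[where B = "2 * E", OF _ GM])
    show "AE \<omega> in M. norm (G \<omega>) \<le> 2 * E"
      using rng by eventually_elim (use exp_S_increment_bounded[OF s] in \<open>auto simp: G_def E_def\<close>)
  qed
  have "AE \<omega> in M. G \<omega> \<le> ?Q \<omega>"
    using rng
  proof eventually_elim
    case (elim \<omega>)
    have "?Q \<omega> = K \<omega> * (1 + s * l \<omega> * ((X \<omega> - m \<omega>)\<^sup>2 - (v \<omega>)\<^sup>2))"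
      by (simp add: a_def b_def d_def power2_eq_square algebra_simps)
    then show ?case
      using exp_S_increment_le[OF s elim(2,3,1,4), of \<mu> \<sigma>] by (simp add: G_def K_def)
  qed
  from real_cond_exp_mono[OF this iG Q(1)] Q(2)
  have "AE \<omega> in M. real_cond_exp M F G \<omega> \<le> 1"
  proof eventually_elim
    case (elim \<omega>)
    let ?z = "s * l \<omega> * (\<sigma>\<^sup>2 + (m \<omega> - \<mu>)\<^sup>2 - (v \<omega>)\<^sup>2)"
    \<comment> \<open>Replacing \<open>X\<close> and \<open>X\<^sup>2\<close> by their conditional means turns \<open>(X - m)\<^sup>2 - v\<^sup>2\<close> into
      the exponent \<open>\<sigma>\<^sup>2 + (m - \<mu>)\<^sup>2 - v\<^sup>2\<close> of \<open>K\<close> up to the factor \<open>- s l\<close>, so the two exponentials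
      below cancel exactly.\<close>
    have "a \<omega> + b \<omega> * \<mu> + d \<omega> * (\<sigma>\<^sup>2 + \<mu>\<^sup>2) = K \<omega> * (1 + ?z)"
      by (simp add: a_def b_def d_def power2_eq_square algebra_simps)
    also have "\<dots> \<le> K \<omega> * exp ?z"
      by (intro mult_left_mono exp_ge_add_one_self) (simp add: K_def recentring_def)
    also have "\<dots> = 1"
      by (simp add: K_def recentring_def exp_minus)
    finally show ?case using elim by simp
  qed
  then show ?thesis unfolding G_def .
qed

end

section \<open>The canonical filtration\<close>

lemma sets_canonical_filtration:
  "sets (canonical_filtration M X t) =
     sigma_sets (space M) (\<Union>i\<in>{1..t}. {X i -` A \<inter> space M | A. A \<in> sets borel})"
  "space (canonical_filtration M X t) = space M"
  unfolding canonical_filtration_def by (auto intro!: sets_measure_of space_measure_of)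

lemma subalgebra_canonical_filtration:
  assumes "\<And>t. t \<ge> 1 \<Longrightarrow> X t \<in> borel_measurable M"
  shows "subalgebra M (canonical_filtration M X t)"
  unfolding subalgebra_def sets_canonical_filtration
  using assms by (auto intro!: sets.sigma_sets_subset measurable_sets)

lemma filtration_canonical_filtration:
  "filtration (space M) (canonical_filtration M X)"
proof
  fix i j :: nat assume "i \<le> j"
  then have "{1..i} \<subseteq> {1..j}" by auto
  then show "sets (canonical_filtration M X i) \<subseteq> sets (canonical_filtration M X j)"
    unfolding sets_canonical_filtration by (intro sigma_sets_mono' UN_mono) auto
qed (simp add: sets_canonical_filtration)

lemma measurable_canonical_filtration:
  assumes "1 \<le> i" "i \<le> t"
  shows "X i \<in> borel_measurable (canonical_filtration M X t)"
proof (rule measurableI)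
  fix A :: "real set" assume "A \<in> sets borel"
  then have "X i -` A \<inter> space M
      \<in> (\<Union>j\<in>{1..t}. {X j -` A \<inter> space M | A. A \<in> sets borel})"
    using assms by (intro UN_I[of i]) auto
  then show "X i -` A \<inter> space (canonical_filtration M X t) \<in> sets (canonical_filtration M X t)"
    unfolding sets_canonical_filtration by (rule sigma_sets.Basic)
qed simp

lemma measurable_canonical_filtration_mono:
  assumes "f \<in> borel_measurable (canonical_filtration M X i)" "i \<le> t"
  shows "f \<in> borel_measurable (canonical_filtration M X t)"
proof (rule measurable_from_subalg[OF _ assms(1)])
  show "subalgebra (canonical_filtration M X t) (canonical_filtration M X i)"
    using filtration.sets_F_mono[OF filtration_canonical_filtration assms(2)]
    by (simp add: subalgebra_def sets_canonical_filtration(2))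
qed

section \<open>The supermartingale property\<close>

lemma S_process_Suc:
  "S_process s \<mu> \<sigma> X mh sh l (Suc t) \<omega> = S_process s \<mu> \<sigma> X mh sh l t \<omega> *
     exp (S_increment s \<mu> \<sigma> (X (Suc t) \<omega>) (mh (Suc t) \<omega>) (sh (Suc t) \<omega>) (l (Suc t) \<omega>))"
  unfolding S_process_def S_increment_def by (simp add: exp_add[symmetric])

text \<open>
  The almost sure bound \<open>(2 E)\<^sup>t\<close> on the process at time \<open>t\<close> supplies integrability; after that the
  past value, nonnegative and measurable at time \<open>t\<close>, multiplies a factor whose conditional
  expectation is at most \<open>1\<close>.
\<close>

lemma nonneg_supermartingale_S_process:
  fixes M :: "'a measure" and X mh sh l :: "nat \<Rightarrow> 'a \<Rightarrow> real" and \<mu> \<sigma> :: real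
  assumes s: "s \<in> {1, -1}"
    and "prob_space M"
    and XM: "\<And>t. t \<ge> 1 \<Longrightarrow> X t \<in> borel_measurable M"
    and X: "\<And>t. t \<ge> 1 \<Longrightarrow> AE \<omega> in M. X t \<omega> \<in> {0..1}"
    and m1: "\<And>t. t \<ge> 1 \<Longrightarrow>
           AE \<omega> in M. real_cond_exp M (canonical_filtration M X (t - 1)) (X t) \<omega> = \<mu>"
    and var: "\<And>t. t \<ge> 1 \<Longrightarrow>
           AE \<omega> in M. real_cond_var M (canonical_filtration M X (t - 1)) (X t) \<omega> = \<sigma>\<^sup>2"
    and mhF: "predictable (canonical_filtration M X) mh"
    and mh: "\<And>i. i \<ge> 1 \<Longrightarrow> AE \<omega> in M. mh i \<omega> \<in> {0..1}"
    and shF: "predictable (canonical_filtration M X) sh"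
    and sh: "\<And>i. i \<ge> 1 \<Longrightarrow> AE \<omega> in M. sh i \<omega> \<in> {0..1}"
    and lF: "predictable (canonical_filtration M X) l"
    and l: "\<And>i. i \<ge> 1 \<Longrightarrow> AE \<omega> in M. l i \<omega> \<in> {0..<1}"
  shows "nonneg_supermartingale M (canonical_filtration M X) (S_process s \<mu> \<sigma> X mh sh l)"
proof -
  interpret prob_space M by fact
  let ?F = "canonical_filtration M X"
  let ?S = "S_process s \<mu> \<sigma> X mh sh l"
  define G where "G i \<omega> = exp (S_increment s \<mu> \<sigma> (X i \<omega>) (mh i \<omega>) (sh i \<omega>) (l i \<omega>))" for i \<omega>
  define E where "E = exp (\<sigma>\<^sup>2 + (1 + \<bar>\<mu>\<bar>)\<^sup>2 + 1)"
  have Suc: "?S (Suc t) = (\<lambda>\<omega>. ?S t \<omega> * G (Suc t) \<omega>)" for t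
    by (simp add: fun_eq_iff S_process_Suc G_def)
  have sub: "subalgebra M (?F t)" for t
    by (rule subalgebra_canonical_filtration[OF XM])
  have pred: "mh (Suc t) \<in> borel_measurable (?F t)" "sh (Suc t) \<in> borel_measurable (?F t)"
      "l (Suc t) \<in> borel_measurable (?F t)" for t
    using mhF shF lF by (auto simp: predictable_def dest: spec[of _ "Suc t"])
  have GF: "G (Suc t) \<in> borel_measurable (?F (Suc t))" for t
  proof -
    note [measurable] = measurable_canonical_filtration[of "Suc t" "Suc t" X M]
      pred[THEN measurable_canonical_filtration_mono, of t "Suc t"]
    show ?thesis
      unfolding G_def S_increment_def psi_E_def by measurable
  qed
  have SF: "?S t \<in> borel_measurable (?F t)" for t
  proof (induction t)
    case 0
    show ?case by (simp add: S_process_def)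
  next
    case (Suc t)
    have "?S t \<in> borel_measurable (?F (Suc t))"
      by (rule measurable_canonical_filtration_mono[OF Suc]) simp
    then show ?case
      unfolding \<open>?S (Suc t) = _\<close> using GF by (rule borel_measurable_times)
  qed
  have Gbound: "AE \<omega> in M. G (Suc t) \<omega> \<le> 2 * E" for t
    using X[of "Suc t"] mh[of "Suc t"] sh[of "Suc t"] l[of "Suc t"]
    unfolding G_def E_def
    by (auto elim!: eventually_elim2 intro!: exp_S_increment_bounded[OF s])
  have Sbound: "AE \<omega> in M. \<bar>?S t \<omega>\<bar> \<le> (2 * E) ^ t" for t
  proof (induction t)
    case 0
    show ?case by (simp add: S_process_def)
  next
    case (Suc t)
    from Suc Gbound[of t] show ?case
    proof eventually_elim
      case (elim \<omega>)
      have "\<bar>?S t \<omega>\<bar> * \<bar>G (Suc t) \<omega>\<bar> \<le> (2 * E) ^ t * (2 * E)"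
        using elim by (intro mult_mono) (auto simp: G_def E_def)
      then show ?case by (simp add: \<open>?S (Suc t) = _\<close> abs_mult mult.commute)
    qed
  qed
  have int: "integrable M (?S t)" for t
    using Sbound[of t] measurable_from_subalg[OF sub SF]
    by (intro integrable_const_bound[where B = "(2 * E) ^ t"]) auto
  have step: "AE \<omega> in M. real_cond_exp M (?F t) (?S (t + 1)) \<omega> \<le> ?S t \<omega>" for t
  proof -
    interpret F: finite_measure_subalgebra M "?F t"
      by unfold_locales (rule sub)
    have "AE \<omega> in M. real_cond_exp M (?F t) (G (Suc t)) \<omega> \<le> 1"
      unfolding G_def
      using X[of "Suc t"] mh[of "Suc t"] sh[of "Suc t"] l[of "Suc t"]
        m1[of "Suc t"] var[of "Suc t"] XM[of "Suc t"] pred[of t]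
      by (intro F.real_cond_exp_exp_S_increment_le_1[OF s]) auto
    moreover have "AE \<omega> in M. real_cond_exp M (?F t) (\<lambda>\<omega>. ?S t \<omega> * G (Suc t) \<omega>) \<omega>
        = ?S t \<omega> * real_cond_exp M (?F t) (G (Suc t)) \<omega>"
      using int[of "Suc t"] unfolding Suc
      by (intro F.real_cond_exp_mult SF measurable_from_subalg[OF sub GF])
    ultimately show ?thesis
      unfolding Suc_eq_plus1[symmetric] Suc
    proof eventually_elim
      case (elim \<omega>)
      have "?S t \<omega> * real_cond_exp M (?F t) (G (Suc t)) \<omega> \<le> ?S t \<omega> * 1"
        using elim by (intro mult_left_mono) (auto simp: S_process_def)
      then show ?case using elim by simp
    qed
  qed
  show ?thesis
    unfolding nonneg_supermartingale_def supermartingale_def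
    using filtration_canonical_filtration sub SF int step by (auto simp: S_process_def)
qed

theorem theorem4p1:
  fixes M :: "'a measure"
    and X mh sh l :: "nat \<Rightarrow> 'a \<Rightarrow> real"
    and \<mu> \<sigma> :: real
  assumes "prob_space M"
    and "\<And>t. t \<ge> 1 \<Longrightarrow> X t \<in> borel_measurable M"
    and "\<And>t. t \<ge> 1 \<Longrightarrow> AE \<omega> in M. X t \<omega> \<in> {0..1}"
    and "\<And>t. t \<ge> 1 \<Longrightarrow>
           AE \<omega> in M. real_cond_exp M (canonical_filtration M X (t - 1)) (X t) \<omega> = \<mu>"
    and "\<And>t. t \<ge> 1 \<Longrightarrow>
           AE \<omega> in M. real_cond_var M (canonical_filtration M X (t - 1)) (X t) \<omega> = \<sigma>\<^sup>2"
    and "predictable (canonical_filtration M X) mh"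
    and "\<And>i. i \<ge> 1 \<Longrightarrow> AE \<omega> in M. mh i \<omega> \<in> {0..1}"
    and "predictable (canonical_filtration M X) sh"
    and "\<And>i. i \<ge> 1 \<Longrightarrow> AE \<omega> in M. sh i \<omega> \<in> {0..1}"
    and "predictable (canonical_filtration M X) l"
    and "\<And>i. i \<ge> 1 \<Longrightarrow> AE \<omega> in M. l i \<omega> \<in> {0..<1}"
  shows "nonneg_supermartingale M (canonical_filtration M X) (S_process 1 \<mu> \<sigma> X mh sh l) \<and>
         nonneg_supermartingale M (canonical_filtration M X) (S_process (-1) \<mu> \<sigma> X mh sh l)"
  using nonneg_supermartingale_S_process[OF _ assms] by simp

end
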